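(* For each $n\ge 0$, \[ \hat{B}_n(s,t)=\frac{1}{n!}\sum_{k=0}^n {n\brack k}\,\bigl|\mathrm{Bal}^s[k]\bigr|\,\bigl|\mathrm{Bal}^t[k]\bigr|. \]
   Context: A Burge matrix is a matrix with nonnegative integer entries in which every row and every column has a nonzero entry; its size is the sum of its entries; $\mathcal{M}[n]$ denotes the set of Burge matrices of size $n$. For indeterminates $s,t$, the two-sided Caylerian polynomial is $\hat{B}_n(s,t)=\sum_{A\in\mathcal{M}[n]}s^{\mathrm{row}(A)}t^{\mathrm{col}(A)}$, where $\mathrm{row}(A),\mathrm{col}(A)$ are the numbers of rows and columns of $A$. A ballot of $[k]=\{1,\dots,k\}$ is an ordered set partition, i.e. a sequence $B_1\cdots B_j$ of disjoint nonempty sets whose union is $[k]$, with $j$ its number of blocks; $|\mathrm{Bal}^t[k]|=\sum_{w}t^{\mathrm{blocks}(w)}$, the sum over all ballots $w$ of $[k]$. ${n\brack k}$ is the unsigned Stirling number of the first kind. *)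

theory Defs
  imports
    "HOL-Library.Disjoint_Sets"
    "HOL-Computational_Algebra.Polynomial"
    "HOL-Combinatorics.Stirling"
    "Jordan_Normal_Form.Matrix"
begin

definition mat_size :: "nat mat \<Rightarrow> nat" where
  "mat_size A = (\<Sum>i<dim_row A. \<Sum>j<dim_col A. A $$ (i, j))"

(* The 0 x 0 matrix is a Burge matrix (of size 0); r x 0 and 0 x c matrices with r, c > 0 are not,
   since they have an empty row or column without nonzero entry. *)
definition burge_matrix :: "nat mat \<Rightarrow> bool" where
  "burge_matrix A \<longleftrightarrow>
     (\<forall>i<dim_row A. \<exists>j<dim_col A. A $$ (i, j) \<noteq> 0) \<and>
     (\<forall>j<dim_col A. \<exists>i<dim_row A. A $$ (i, j) \<noteq> 0)"

definition burge_matrices :: "nat \<Rightarrow> nat mat set" where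
  "burge_matrices n = {A. burge_matrix A \<and> mat_size A = n}"

definition two_sided_caylerian :: "nat \<Rightarrow> 'a::comm_semiring_1 \<Rightarrow> 'a \<Rightarrow> 'a" where
  "two_sided_caylerian n s t = (\<Sum>A\<in>burge_matrices n. s ^ dim_row A * t ^ dim_col A)"

definition ballots :: "'b set \<Rightarrow> 'b set list set" where
  "ballots X = {w. distinct w \<and> partition_on X (set w)}"

definition ballot_poly :: "nat \<Rightarrow> 'a::comm_semiring_1 \<Rightarrow> 'a" where
  "ballot_poly k t = (\<Sum>w\<in>ballots {1..k}. t ^ length w)"

(* The two indeterminates of the bivariate polynomial ring 'a[s][t]. *)
definition indet_s :: "'a::comm_semiring_1 poly poly" where
  "indet_s = [:[:0, 1:]:]"

definition indet_t :: "'a::comm_semiring_1 poly poly" where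
  "indet_t = [:0, 1:]"

(* Both index sets are finite, so the sums above are genuine. *)
lemma finite_ballots:
  assumes "finite X"
  shows "finite (ballots X)"
proof (rule finite_subset)
  show "ballots X \<subseteq> {w. set w \<subseteq> Pow X \<and> length w \<le> card (Pow X)}"
  proof
    fix w assume w: "w \<in> ballots X"
    then have sub: "set w \<subseteq> Pow X" by (auto simp: ballots_def partition_on_def)
    moreover have "length w \<le> card (Pow X)"
      using w sub assms card_mono[of "Pow X" "set w"]
      by (simp add: ballots_def distinct_card)
    ultimately show "w \<in> {w. set w \<subseteq> Pow X \<and> length w \<le> card (Pow X)}" by simp
  qed
  show "finite {w. set w \<subseteq> Pow X \<and> length w \<le> card (Pow X)}"
    using assms by (intro finite_lists_length_le) simp
qed

lemma finite_burge_matrices: "finite (burge_matrices n)"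
proof (rule finite_subset)
  show "burge_matrices n \<subseteq> (\<Union>d\<in>{..n} \<times> {..n}.
      (\<lambda>f. mat (fst d) (snd d) f) ` (({..<fst d} \<times> {..<snd d}) \<rightarrow>\<^sub>E {..n}))"
  proof
    fix A assume A: "A \<in> burge_matrices n"
    then have b: "burge_matrix A"
      and n: "(\<Sum>i<dim_row A. \<Sum>j<dim_col A. A $$ (i, j)) = n"
      by (auto simp: burge_matrices_def mat_size_def)
    have n': "(\<Sum>j<dim_col A. \<Sum>i<dim_row A. A $$ (i, j)) = n"
      using n by (subst sum.swap)
    have "(\<Sum>i<dim_row A. 1) \<le> (\<Sum>i<dim_row A. \<Sum>j<dim_col A. A $$ (i, j))"
    proof (rule sum_mono)
      fix i assume "i \<in> {..<dim_row A}"
      then obtain j where "j < dim_col A" "A $$ (i, j) \<noteq> 0"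
        using b by (auto simp: burge_matrix_def)
      then show "1 \<le> (\<Sum>j<dim_col A. A $$ (i, j))"
        using member_le_sum[of j "{..<dim_col A}" "\<lambda>j. A $$ (i, j)"] by simp
    qed
    then have r: "dim_row A \<le> n" using n by simp
    have "(\<Sum>j<dim_col A. 1) \<le> (\<Sum>j<dim_col A. \<Sum>i<dim_row A. A $$ (i, j))"
    proof (rule sum_mono)
      fix j assume "j \<in> {..<dim_col A}"
      then obtain i where "i < dim_row A" "A $$ (i, j) \<noteq> 0"
        using b by (auto simp: burge_matrix_def)
      then show "1 \<le> (\<Sum>i<dim_row A. A $$ (i, j))"
        using member_le_sum[of i "{..<dim_row A}" "\<lambda>i. A $$ (i, j)"] by simp
    qed
    then have c: "dim_col A \<le> n" using n' by simp
    have e: "A $$ (i, j) \<le> n" if "i < dim_row A" "j < dim_col A" for i j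
    proof -
      have "A $$ (i, j) \<le> (\<Sum>j<dim_col A. A $$ (i, j))"
        using that by (intro member_le_sum[of j "{..<dim_col A}" "\<lambda>j. A $$ (i, j)"]) auto
      also have "\<dots> \<le> (\<Sum>i<dim_row A. \<Sum>j<dim_col A. A $$ (i, j))"
        using that
        by (intro member_le_sum[of i "{..<dim_row A}" "\<lambda>i. \<Sum>j<dim_col A. A $$ (i, j)"]) auto
      finally show ?thesis using n by simp
    qed
    let ?f = "restrict (\<lambda>ij. A $$ ij) ({..<dim_row A} \<times> {..<dim_col A})"
    have "A = mat (dim_row A) (dim_col A) ?f" by (rule eq_matI) auto
    moreover have "?f \<in> ({..<dim_row A} \<times> {..<dim_col A}) \<rightarrow>\<^sub>E {..n}" using e by auto
    ultimately show "A \<in> (\<Union>d\<in>{..n} \<times> {..n}.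
      (\<lambda>f. mat (fst d) (snd d) f) ` (({..<fst d} \<times> {..<snd d}) \<rightarrow>\<^sub>E {..n}))"
      using r c by (intro UN_I[of "(dim_row A, dim_col A)"]) auto
  qed
  show "finite (\<Union>d\<in>{..n} \<times> {..n}.
      (\<lambda>f. mat (fst d) (snd d) f) ` (({..<fst d} \<times> {..<snd d}) \<rightarrow>\<^sub>E {..n}))"
    by (intro finite_UN_I finite_imageI finite_PiE) auto
qed

end

theory Submission
  imports Defs
begin

text \<open>
  Let \<open>M(i,j)\<close> be the number of \<open>i \<times> j\<close> Burge matrices of size \<open>n\<close> and \<open>b(k,i)\<close> the number of ballots
  of a \<open>k\<close>-set with \<open>i\<close> blocks. Every \<open>p \<times> q\<close> matrix of size \<open>n\<close> restricts to a Burge matrix on its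
  nonzero rows and columns, and every function from a \<open>k\<close>-set to a \<open>p\<close>-set is a surjection onto its
  image, that is, a ballot. Hence summing either side of
  \<open>n! M(i,j) = (\<Sum>k\<le>n. stirling n k * b(k,i) * b(k,j))\<close> with \<open>i = |I|\<close> and \<open>j = |J|\<close> over all sets \<open>I\<close> of
  rows and \<open>J\<close> of columns yields the two sides of
  \<open>n! * (pq+n-1 choose n) = (\<Sum>k\<le>n. stirling n k * (pq)^k)\<close>, and such subset sums, for all \<open>p\<close> and \<open>q\<close>,
  determine the summands.
\<close>

section \<open>Inversion of subset sums\<close>

text \<open>Strong induction on \<open>m\<close>: the only subset of \<open>{..<m}\<close> with
  \<open>m\<close> elements is the whole set, so in the sums for \<open>p = m\<close> all other
  terms agree by induction and cancel.\<close>

lemma subset_sums_determine: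
  fixes f g :: "nat \<Rightarrow> 'a::cancel_comm_monoid_add"
  assumes "\<And>p::nat. (\<Sum>I\<in>Pow {..<p}. f (card I)) = (\<Sum>I\<in>Pow {..<p}. g (card I))"
  shows "f m = g m"
proof (induction m rule: less_induct)
  case (less m)
  have split: "(\<Sum>I\<in>Pow {..<m}. h (card I)) = h m + (\<Sum>I\<in>Pow {..<m} - {{..<m}}. h (card I))"
    for h :: "nat \<Rightarrow> 'a"
    by (subst sum.remove[of _ "{..<m}"]) auto
  have "(\<Sum>I\<in>Pow {..<m} - {{..<m}}. f (card I)) = (\<Sum>I\<in>Pow {..<m} - {{..<m}}. g (card I))"
  proof (rule sum.cong)
    fix I assume "I \<in> Pow {..<m} - {{..<m}}"
    then have "I \<subset> {..<m}" by auto
    then have "card I < m" using psubset_card_mono[of "{..<m}" I] by simp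
    then show "f (card I) = g (card I)" by (rule less)
  qed simp
  then show ?case using assms[of m] split[of f] split[of g] by simp
qed

section \<open>Counting weightings: stars and bars, Stirling numbers\<close>

text \<open>The value outside \<open>X\<close> is 0 rather than \<open>undefined\<close>, so a
  weighting of a subset is literally a weighting of any finite superset.\<close>

definition weightings :: "nat \<Rightarrow> 'b set \<Rightarrow> ('b \<Rightarrow> nat) set" where
  "weightings n X = {f. (\<forall>x. x \<notin> X \<longrightarrow> f x = 0) \<and> sum f X = n}"

lemma weightings_support: "f \<in> weightings n X \<Longrightarrow> f x \<noteq> 0 \<Longrightarrow> x \<in> X"
  by (rule ccontr) (simp add: weightings_def)

lemma bij_betw_weightings_lists:
  assumes e: "bij_betw e {..<m} X"
  shows "bij_betw (\<lambda>f. map (f \<circ> e) [0..<m]) (weightings n X) {l. length l = m \<and> sum_list l = n}"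
proof (rule bij_betwI')
  fix f g assume fg: "f \<in> weightings n X" "g \<in> weightings n X"
  show "(map (f \<circ> e) [0..<m] = map (g \<circ> e) [0..<m]) = (f = g)"
  proof
    assume "map (f \<circ> e) [0..<m] = map (g \<circ> e) [0..<m]"
    then have "\<forall>a<m. f (e a) = g (e a)" by simp
    then have "f x = g x" if "x \<in> X" for x using that e by (auto simp: bij_betw_def)
    moreover have "f x = g x" if "x \<notin> X" for x using that fg by (simp add: weightings_def)
    ultimately show "f = g" by blast
  qed simp
next
  fix f assume "f \<in> weightings n X"
  then show "map (f \<circ> e) [0..<m] \<in> {l. length l = m \<and> sum_list l = n}"
    using sum.reindex_bij_betw[OF e, of f]
    by (simp add: weightings_def interv_sum_list_conv_sum_set_nat atLeast0LessThan)
next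
  fix l :: "nat list" assume l: "l \<in> {l. length l = m \<and> sum_list l = n}"
  define f where "f x = (if x \<in> X then l ! inv_into {..<m} e x else 0)" for x
  have fe: "f (e a) = l ! a" if "a < m" for a
    using that e by (auto simp: f_def bij_betw_def inv_into_f_f)
  have "sum f X = (\<Sum>a<m. l ! a)"
    using sum.reindex_bij_betw[OF e, of f] fe by simp
  then have "f \<in> weightings n X"
    using l by (auto simp: weightings_def f_def sum_list_sum_nth atLeast0LessThan)
  moreover have "l = map (f \<circ> e) [0..<m]"
    using l fe by (intro nth_equalityI) auto
  ultimately show "\<exists>f\<in>weightings n X. l = map (f \<circ> e) [0..<m]" by blast
qed

text \<open>Stars and bars: an enumeration of \<open>X\<close> turns weightings into lists with
  prescribed length and sum.\<close>

lemma card_weightings: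
  assumes "finite X"
  shows "card (weightings n X) = (n + card X - 1) choose n"
proof -
  obtain e where "bij_betw e {..<card X} X"
    using ex_bij_betw_nat_finite[OF assms] by (auto simp: atLeast0LessThan)
  then show ?thesis
    using bij_betw_same_card[OF bij_betw_weightings_lists] card_length_sum_list by metis
qed

lemma finite_weightings:
  assumes "finite X"
  shows "finite (weightings n X)"
proof -
  obtain e where "bij_betw e {..<card X} X"
    using ex_bij_betw_nat_finite[OF assms] by (auto simp: atLeast0LessThan)
  moreover have "finite {l::nat list. length l = card X \<and> sum_list l = n}"
    by (rule finite_subset[OF _ finite_lists_length_eq[of "{..n}" "card X"]])
       (auto intro: member_le_sum_list)
  ultimately show ?thesis
    using bij_betw_finite[OF bij_betw_weightings_lists] by metis
qed

text \<open>Both sides are the rising factorial \<open>pochhammer m n\<close>, whose coefficients in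
  powers of \<open>m\<close> are the unsigned Stirling numbers of the first kind.\<close>

lemma fact_times_multichoose: "fact n * ((n + m - 1) choose n) = (\<Sum>k\<le>n. stirling n k * m ^ k)"
proof -
  have "pochhammer m n = fact n * ((n + m - 1) choose n)"
  proof (cases m)
    \<comment> \<open>Truncated subtraction gives the right values here:
      \<open>n - 1 choose n\<close> is 1 for \<open>n = 0\<close> and 0 otherwise.\<close>
    case 0
    then show ?thesis by (cases n) (simp_all add: pochhammer_0_left binomial_eq_0)
  next
    case (Suc r)
    have "fact r * pochhammer (Suc r) n = (fact (r + n) :: nat)"
      by (induction n) (auto simp: pochhammer_Suc algebra_simps)
    also have "\<dots> = fact r * (fact n * ((r + n) choose n))"
      using binomial_fact_lemma[of n "r + n"] by (simp add: algebra_simps)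
    finally show ?thesis by (simp add: Suc add.commute)
  qed
  then show ?thesis using stirling_pochhammer[of n m] by simp
qed

section \<open>Burge matrices inside arbitrary matrices\<close>

text \<open>Burge matrices whose rows and columns keep their original labels, so that deleting zero
  rows and columns leaves the function itself unchanged.\<close>

definition burge_weightings :: "nat \<Rightarrow> 'b set \<Rightarrow> 'c set \<Rightarrow> ('b \<times> 'c \<Rightarrow> nat) set" where
  "burge_weightings n I J = {f \<in> weightings n (I \<times> J).
     (\<forall>i\<in>I. \<exists>j\<in>J. f (i, j) \<noteq> 0) \<and> (\<forall>j\<in>J. \<exists>i\<in>I. f (i, j) \<noteq> 0)}"

lemma weightings_eq_Union_burge:
  assumes "finite X" "finite Y"
  shows "weightings n (X \<times> Y) = (\<Union>(I, J)\<in>Pow X \<times> Pow Y. burge_weightings n I J)"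
proof (intro equalityI subsetI)
  fix f assume f: "f \<in> weightings n (X \<times> Y)"
  \<comment> \<open>\<open>I\<close> and \<open>J\<close> index the nonzero rows and columns; the
    discarded entries are all 0, so the total stays \<open>n\<close>.\<close>
  define I where "I = {i. \<exists>j. f (i, j) \<noteq> 0}"
  define J where "J = {j. \<exists>i. f (i, j) \<noteq> 0}"
  have "i \<in> X \<and> j \<in> Y" if "f (i, j) \<noteq> 0" for i j
    using weightings_support[OF f that] by simp
  then have sub: "I \<subseteq> X" "J \<subseteq> Y" unfolding I_def J_def by blast+
  have "sum f (I \<times> J) = sum f (X \<times> Y)"
    using sub assms by (intro sum.mono_neutral_left) (auto simp: I_def J_def)
  then have "f \<in> burge_weightings n I J"
    using f by (auto simp: burge_weightings_def weightings_def I_def J_def)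
  then show "f \<in> (\<Union>(I, J)\<in>Pow X \<times> Pow Y. burge_weightings n I J)" using sub by blast
next
  fix f assume "f \<in> (\<Union>(I, J)\<in>Pow X \<times> Pow Y. burge_weightings n I J)"
  then obtain I J where IJ: "I \<times> J \<subseteq> X \<times> Y" and f: "f \<in> weightings n (I \<times> J)"
    by (auto simp: burge_weightings_def)
  have "sum f (I \<times> J) = sum f (X \<times> Y)"
    using assms IJ weightings_support[OF f] by (intro sum.mono_neutral_left) blast+
  moreover have "f x = 0" if "x \<notin> X \<times> Y" for x
    using that IJ weightings_support[OF f] by blast
  ultimately show "f \<in> weightings n (X \<times> Y)" using f by (simp add: weightings_def)
qed

text \<open>The function alone determines its index sets, which makes the union over all
  \<open>I\<close> and \<open>J\<close> disjoint.\<close>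

lemma burge_weightings_support:
  assumes "f \<in> burge_weightings n I J"
  shows "I = {i. \<exists>j. f (i, j) \<noteq> 0}" "J = {j. \<exists>i. f (i, j) \<noteq> 0}"
proof -
  have f: "f \<in> weightings n (I \<times> J)" "\<forall>i\<in>I. \<exists>j\<in>J. f (i, j) \<noteq> 0" "\<forall>j\<in>J. \<exists>i\<in>I. f (i, j) \<noteq> 0"
    using assms by (simp_all add: burge_weightings_def)
  have "i \<in> I \<and> j \<in> J" if "f (i, j) \<noteq> 0" for i j
    using weightings_support[OF f(1) that] by simp
  then show "I = {i. \<exists>j. f (i, j) \<noteq> 0}" "J = {j. \<exists>i. f (i, j) \<noteq> 0}"
    using f(2,3) by blast+
qed

lemma finite_burge_weightings:
  assumes "finite I" "finite J"
  shows "finite (burge_weightings n I J)"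
  using assms finite_subset[of _ "weightings n (I \<times> J)"] finite_weightings[of "I \<times> J"]
  by (auto simp: burge_weightings_def)

lemma card_weightings_Times:
  fixes X :: "'b set" and Y :: "'c set"
  assumes "finite X" "finite Y"
  shows "card (weightings n (X \<times> Y)) = (\<Sum>I\<in>Pow X. \<Sum>J\<in>Pow Y. card (burge_weightings n I J))"
proof -
  have "card (\<Union>IJ\<in>Pow X \<times> Pow Y. case IJ of (I, J) \<Rightarrow> burge_weightings n I J) =
      (\<Sum>IJ\<in>Pow X \<times> Pow Y. card (case IJ of (I, J) \<Rightarrow> burge_weightings n I J))"
  proof (rule card_UN_disjoint)
    show "finite (Pow X \<times> Pow Y)" using assms by simp
    show "\<forall>IJ\<in>Pow X \<times> Pow Y. finite (case IJ of (I, J) \<Rightarrow> burge_weightings n I J)"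
      using assms by (auto intro!: finite_burge_weightings intro: finite_subset)
    show "\<forall>P\<in>Pow X \<times> Pow Y. \<forall>Q\<in>Pow X \<times> Pow Y. P \<noteq> Q \<longrightarrow>
        (case P of (I, J) \<Rightarrow> burge_weightings n I J) \<inter> (case Q of (I, J) \<Rightarrow> burge_weightings n I J) = {}"
    proof (intro ballI impI, elim SigmaE, hypsubst, unfold prod.case)
      fix I I' :: "'b set" and J J' :: "'c set" assume "(I, J) \<noteq> (I', J')"
      moreover have "I = I'" "J = J'" if "f \<in> burge_weightings n I J" "f \<in> burge_weightings n I' J'" for f
        using burge_weightings_support[OF that(1)] burge_weightings_support[OF that(2)] by simp_all
      ultimately show "burge_weightings n I J \<inter> burge_weightings n I' J' = {}" by blast
    qed
  qed
  then show ?thesis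
    using weightings_eq_Union_burge[OF assms] by (simp add: sum.cartesian_product case_prod_beta)
qed

text \<open>Enumerations \<open>e\<close> and \<open>d\<close> of the labels translate labelled rows
  and columns into matrix positions.\<close>

lemma bij_betw_burge_weightings:
  assumes e: "bij_betw e {..<p} I" and d: "bij_betw d {..<q} J"
  shows "bij_betw (\<lambda>f. mat p q (\<lambda>(a, b). f (e a, d b))) (burge_weightings n I J)
    {A \<in> burge_matrices n. dim_row A = p \<and> dim_col A = q}"
proof (rule bij_betwI')
  have I: "I = e ` {..<p}" and J: "J = d ` {..<q}" using e d by (auto simp: bij_betw_def)
  have size: "sum f (I \<times> J) = mat_size (mat p q (\<lambda>(a, b). f (e a, d b)))" for f
  proof -
    have "sum f (I \<times> J) = (\<Sum>i\<in>I. \<Sum>j\<in>J. f (i, j))" by (simp add: sum.cartesian_product)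
    also have "\<dots> = (\<Sum>a<p. \<Sum>b<q. f (e a, d b))"
      unfolding sum.reindex_bij_betw[OF e, symmetric] sum.reindex_bij_betw[OF d, symmetric] ..
    finally show ?thesis by (simp add: mat_size_def)
  qed
  {
    fix f g assume fg: "f \<in> burge_weightings n I J" "g \<in> burge_weightings n I J"
    show "(mat p q (\<lambda>(a, b). f (e a, d b)) = mat p q (\<lambda>(a, b). g (e a, d b))) = (f = g)"
    proof
      assume eq: "mat p q (\<lambda>(a, b). f (e a, d b)) = mat p q (\<lambda>(a, b). g (e a, d b))"
      have "f (e a, d b) = g (e a, d b)" if "a < p" "b < q" for a b
        using that arg_cong[OF eq, of "\<lambda>A. A $$ (a, b)"] by simp
      then have "f x = g x" if "x \<in> I \<times> J" for x using that I J by auto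
      moreover have "f x = g x" if "x \<notin> I \<times> J" for x
      proof -
        have "f \<in> weightings n (I \<times> J)" "g \<in> weightings n (I \<times> J)"
          using fg by (simp_all add: burge_weightings_def)
        then show ?thesis using that weightings_support by metis
      qed
      ultimately show "f = g" by blast
    qed simp
  next
    fix f assume "f \<in> burge_weightings n I J"
    then have "sum f (I \<times> J) = n" "\<forall>a<p. \<exists>b<q. f (e a, d b) \<noteq> 0" "\<forall>b<q. \<exists>a<p. f (e a, d b) \<noteq> 0"
      unfolding burge_weightings_def weightings_def I J by auto
    then show "mat p q (\<lambda>(a, b). f (e a, d b)) \<in> {A \<in> burge_matrices n. dim_row A = p \<and> dim_col A = q}"
      using size[of f] by (simp add: burge_matrices_def burge_matrix_def cong: conj_cong)
  next
    fix A assume A: "A \<in> {A \<in> burge_matrices n. dim_row A = p \<and> dim_col A = q}"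
    \<comment> \<open>The preimage of \<open>A\<close>: look up the positions of both labels, and
      extend by 0 as \<open>weightings\<close> demands.\<close>
    define f where "f = (\<lambda>(i, j). if i \<in> I \<and> j \<in> J
      then A $$ (inv_into {..<p} e i, inv_into {..<q} d j) else 0)"
    have fA: "f (e a, d b) = A $$ (a, b)" if "a < p" "b < q" for a b
      using that e d by (auto simp: f_def bij_betw_def inv_into_f_f)
    have mA: "A = mat p q (\<lambda>(a, b). f (e a, d b))"
      using A fA by (intro eq_matI) auto
    then have "sum f (I \<times> J) = n" using A size[of f] by (simp add: burge_matrices_def)
    moreover have "\<forall>i\<in>I. \<exists>j\<in>J. f (i, j) \<noteq> 0" "\<forall>j\<in>J. \<exists>i\<in>I. f (i, j) \<noteq> 0"
      using A fA unfolding I J by (fastforce simp: burge_matrices_def burge_matrix_def)+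
    ultimately have "f \<in> burge_weightings n I J"
      by (auto simp: burge_weightings_def weightings_def f_def)
    then show "\<exists>f\<in>burge_weightings n I J. A = mat p q (\<lambda>(a, b). f (e a, d b))" using mA by blast
  }
qed

definition burge_count :: "nat \<Rightarrow> nat \<Rightarrow> nat \<Rightarrow> nat" where
  "burge_count n p q = card {A \<in> burge_matrices n. dim_row A = p \<and> dim_col A = q}"

text \<open>The count depends on the label sets only through their sizes, the form that
  \<open>subset_sums_determine\<close> needs.\<close>

lemma card_burge_weightings:
  assumes "finite I" "finite J"
  shows "card (burge_weightings n I J) = burge_count n (card I) (card J)"
proof -
  obtain e d where "bij_betw e {..<card I} I" "bij_betw d {..<card J} J"
    using ex_bij_betw_nat_finite assms by (metis atLeast0LessThan)
  then show ?thesis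
    unfolding burge_count_def by (rule bij_betw_same_card[OF bij_betw_burge_weightings])
qed

section \<open>Surjections and ballots\<close>

definition surjections :: "'b set \<Rightarrow> 'c set \<Rightarrow> ('b \<Rightarrow> 'c) set" where
  "surjections X I = {f \<in> X \<rightarrow>\<^sub>E I. f ` X = I}"

definition ballot_count :: "nat \<Rightarrow> nat \<Rightarrow> nat" where
  "ballot_count k m = card {w \<in> ballots {1..k}. length w = m}"

text \<open>A ballot is the list of fibres of a surjection, in the order given by \<open>e\<close>:
  surjectivity makes the blocks nonempty, and fibres over different points are disjoint.\<close>

lemma bij_betw_surjections_ballots:
  assumes e: "bij_betw e {..<m} I"
  shows "bij_betw (\<lambda>f. map (\<lambda>a. {x \<in> X. f x = e a}) [0..<m]) (surjections X I)
    {w \<in> ballots X. length w = m}"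
proof (rule bij_betwI')
  have I: "I = e ` {..<m}" and inj: "inj_on e {..<m}" using e by (auto simp: bij_betw_def)
  {
    fix f g assume fg: "f \<in> surjections X I" "g \<in> surjections X I"
    show "(map (\<lambda>a. {x \<in> X. f x = e a}) [0..<m] = map (\<lambda>a. {x \<in> X. g x = e a}) [0..<m]) = (f = g)"
    proof
      assume "map (\<lambda>a. {x \<in> X. f x = e a}) [0..<m] = map (\<lambda>a. {x \<in> X. g x = e a}) [0..<m]"
      then have eq: "{x \<in> X. f x = e a} = {x \<in> X. g x = e a}" if "a < m" for a using that by simp
      show "f = g"
      proof (rule PiE_ext)
        show "f \<in> X \<rightarrow>\<^sub>E I" "g \<in> X \<rightarrow>\<^sub>E I" using fg by (auto simp: surjections_def)
        fix x assume x: "x \<in> X"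
        then have "f x \<in> I" using fg by (auto simp: surjections_def)
        then obtain a where a: "a < m" "f x = e a" using I by auto
        then have "x \<in> {x \<in> X. g x = e a}" using x unfolding eq[OF a(1), symmetric] by simp
        then show "f x = g x" using a by simp
      qed
    qed simp
  next
    fix f assume f: "f \<in> surjections X I"
    then have fX: "f ` X = I" by (simp add: surjections_def)
    let ?B = "\<lambda>a. {x \<in> X. f x = e a}"
    have ne: "?B a \<noteq> {}" if "a < m" for a
    proof -
      have "e a \<in> f ` X" using that fX I by auto
      then show ?thesis by auto
    qed
    have disj: "a = b" if "a < m" "b < m" "x \<in> ?B a" "x \<in> ?B b" for a b x
      using that inj by (auto simp: inj_on_def)
    \<comment> \<open>Equal fibres share a point because they are nonempty, so they lie over the
      same index.\<close>
    have "inj_on ?B {0..<m}"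
    proof (rule inj_onI)
      fix a b assume ab: "a \<in> {0..<m}" "b \<in> {0..<m}" "?B a = ?B b"
      then obtain x where "x \<in> ?B a" using ne[of a] by auto
      then show "a = b" using disj[of a b x] ab by auto
    qed
    then have "distinct (map ?B [0..<m])" by (simp add: distinct_map)
    moreover have "partition_on X (set (map ?B [0..<m]))"
    proof (rule partition_onI)
      show "\<Union> (set (map ?B [0..<m])) = X" using fX I by fastforce
      show "{} \<notin> set (map ?B [0..<m])" using ne by fastforce
      show "disjnt p p'" if pp: "p \<in> set (map ?B [0..<m])" "p' \<in> set (map ?B [0..<m])" "p \<noteq> p'" for p p'
      proof -
        obtain a b where "p = ?B a" "p' = ?B b" "a < m" "b < m"
          using pp(1,2) unfolding set_map set_upt atLeast0LessThan by blast
        then show ?thesis using disj pp(3) unfolding disjnt_def by blast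
      qed
    qed
    ultimately show "map ?B [0..<m] \<in> {w \<in> ballots X. length w = m}" by (simp add: ballots_def)
  next
    fix w assume "w \<in> {w \<in> ballots X. length w = m}"
    then have w: "distinct w" "partition_on X (set w)" "length w = m" by (auto simp: ballots_def)
    have un: "\<Union> (set w) = X" using w(2) by (simp add: partition_on_def)
    \<comment> \<open>Blocks that meet are equal as sets; distinctness of \<open>w\<close> then
      makes their positions equal.\<close>
    have wdisj: "a = b" if "a < m" "b < m" "x \<in> w ! a" "x \<in> w ! b" for a b x
    proof -
      have "w ! a = w ! b"
        using that w disjointD[OF partition_onD2[OF w(2)], of "w ! a" "w ! b"] by auto
      then show ?thesis using that w nth_eq_iff_index_eq[of w a b] by simp
    qed
    have "\<exists>a<m. x \<in> w ! a" if "x \<in> X" for x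
      using that un w(3) by (auto simp: in_set_conv_nth)
    \<comment> \<open>\<open>c x\<close> is the position of the block containing \<open>x\<close>;
      the surjection sought sends \<open>x\<close> to \<open>e (c x)\<close>.\<close>
    then obtain c where c: "\<And>x. x \<in> X \<Longrightarrow> c x < m \<and> x \<in> w ! c x" by metis
    define f where "f = restrict (\<lambda>x. e (c x)) X"
    have sub: "w ! a \<subseteq> X" if "a < m" for a using un that w(3) by auto
    have B: "{x \<in> X. f x = e a} = w ! a" if a: "a < m" for a
    proof (intro equalityI subsetI)
      fix x assume "x \<in> {x \<in> X. f x = e a}"
      then have x: "x \<in> X" "e (c x) = e a" by (auto simp: f_def)
      then have "c x = a" using inj c a by (auto simp: inj_on_def)
      then show "x \<in> w ! a" using c x by auto
    next
      fix x assume x: "x \<in> w ! a"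
      then have "x \<in> X" using sub a by auto
      then have "c x = a" using c wdisj a x by blast
      then show "x \<in> {x \<in> X. f x = e a}" using \<open>x \<in> X\<close> by (simp add: f_def)
    qed
    have "f ` X = I"
    proof (intro equalityI subsetI)
      fix i assume "i \<in> f ` X"
      then show "i \<in> I" using c I by (auto simp: f_def)
    next
      fix i assume "i \<in> I"
      then obtain a where a: "a < m" "i = e a" using I by auto
      then have "w ! a \<noteq> {}" using w by (metis nth_mem partition_onD3)
      then obtain x where "x \<in> w ! a" by blast
      then have "x \<in> {x \<in> X. f x = e a}" by (simp only: B[OF a(1)])
      then show "i \<in> f ` X" using a(2) by (auto intro: rev_image_eqI)
    qed
    then have "f \<in> surjections X I" by (auto simp: surjections_def f_def)
    moreover have "w = map (\<lambda>a. {x \<in> X. f x = e a}) [0..<m]"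
      using B w(3) by (intro nth_equalityI) auto
    ultimately show "\<exists>f\<in>surjections X I. w = map (\<lambda>a. {x \<in> X. f x = e a}) [0..<m]" by blast
  }
qed

lemma card_surjections:
  assumes "finite I"
  shows "card (surjections {1..k} I) = ballot_count k (card I)"
proof -
  obtain e where "bij_betw e {..<card I} I"
    using ex_bij_betw_nat_finite[OF assms] by (auto simp: atLeast0LessThan)
  then show ?thesis
    unfolding ballot_count_def by (rule bij_betw_same_card[OF bij_betw_surjections_ballots])
qed

text \<open>Functions from \<open>{1..k}\<close> to \<open>{..<p}\<close> are sorted by their image
  \<open>I\<close>, onto which they are surjections.\<close>

lemma power_eq_sum_ballot_count: "p ^ k = (\<Sum>I\<in>Pow {..<p}. ballot_count k (card I))"
proof -
  have "p ^ k = card ({1..k} \<rightarrow>\<^sub>E {..<p})" by (simp add: card_PiE)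
  also have "{1..k} \<rightarrow>\<^sub>E {..<p} = (\<Union>I\<in>Pow {..<p}. surjections {1..k} I)"
    by (fastforce simp: surjections_def)
  also have "card \<dots> = (\<Sum>I\<in>Pow {..<p}. card (surjections {1..k} I))"
  proof (rule card_UN_disjoint)
    show "\<forall>I\<in>Pow {..<p}. finite (surjections {1..k} I)"
    proof
      fix I assume "I \<in> Pow {..<p}"
      then have "finite ({1..k} \<rightarrow>\<^sub>E I)" by (intro finite_PiE) (auto intro: finite_subset)
      then show "finite (surjections {1..k} I)" by (simp add: surjections_def)
    qed
  qed (auto simp: surjections_def)
  also have "\<dots> = (\<Sum>I\<in>Pow {..<p}. ballot_count k (card I))"
    by (intro sum.cong card_surjections) (auto intro: finite_subset)
  finally show ?thesis .
qed

section \<open>The identity between coefficients\<close>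

lemma fact_times_burge_count:
  "fact n * burge_count n i j = (\<Sum>k\<le>n. stirling n k * (ballot_count k i * ballot_count k j))"
proof -
  let ?g = "\<lambda>i j. \<Sum>k\<le>n. stirling n k * (ballot_count k i * ballot_count k j)"
  have both: "(\<Sum>I\<in>Pow {..<p}. \<Sum>J\<in>Pow {..<q}. fact n * burge_count n (card I) (card J)) =
      (\<Sum>I\<in>Pow {..<p}. \<Sum>J\<in>Pow {..<q}. ?g (card I) (card J))" (is "?L = ?R") for p q :: nat
  proof -
    \<comment> \<open>The Burge counts add up to the number of all \<open>p\<close> by
      \<open>q\<close> matrices of size \<open>n\<close>, a multichoose number for
      \<open>p * q\<close> cells.\<close>
    have "?L = fact n * card (weightings n ({..<p} \<times> {..<q}))"
      unfolding card_weightings_Times[OF finite_lessThan finite_lessThan] sum_distrib_left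
      by (intro sum.cong refl) (auto simp: card_burge_weightings finite_subset[OF _ finite_lessThan])
    also have "\<dots> = (\<Sum>k\<le>n. stirling n k * (p ^ k * q ^ k))"
      by (simp add: card_weightings fact_times_multichoose power_mult_distrib del: One_nat_def)
    \<comment> \<open>The powers of \<open>p\<close> and \<open>q\<close> expand separately over
      images \<open>I\<close> and \<open>J\<close>.\<close>
    also have "\<dots> = (\<Sum>k\<le>n. \<Sum>I\<in>Pow {..<p}. \<Sum>J\<in>Pow {..<q}.
        stirling n k * (ballot_count k (card I) * ballot_count k (card J)))"
      unfolding power_eq_sum_ballot_count sum_product by (simp add: sum_distrib_left)
    also have "\<dots> = (\<Sum>I\<in>Pow {..<p}. \<Sum>k\<le>n. \<Sum>J\<in>Pow {..<q}.
        stirling n k * (ballot_count k (card I) * ballot_count k (card J)))"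
      by (rule sum.swap)
    also have "\<dots> = ?R" by (intro sum.cong refl sum.swap)
    finally show ?thesis .
  qed
  \<comment> \<open>Inversion is applied twice: first in the row index with \<open>q\<close> fixed,
    then in the column index with \<open>i\<close> fixed.\<close>
  have "(\<Sum>J\<in>Pow {..<q}. fact n * burge_count n i (card J)) = (\<Sum>J\<in>Pow {..<q}. ?g i (card J))" for q :: nat
    by (rule subset_sums_determine[where f = "\<lambda>i. \<Sum>J\<in>Pow {..<q}. fact n * burge_count n i (card J)"
        and g = "\<lambda>i. \<Sum>J\<in>Pow {..<q}. ?g i (card J)", OF both])
  then show ?thesis
    by (rule subset_sums_determine[where f = "\<lambda>j. fact n * burge_count n i j" and g = "?g i"])
qed

section \<open>From coefficients to polynomials\<close>

text \<open>Ballots are grouped by length. \<open>T\<close> may contain further exponents, whose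
  coefficients are 0; this freedom lets different polynomials share one index set.\<close>

lemma ballot_poly_eq_sum_ballot_count:
  assumes "finite T" "length ` ballots {1..k} \<subseteq> T"
  shows "ballot_poly k t = (\<Sum>m\<in>T. of_nat (ballot_count k m) * t ^ m)"
proof -
  have "ballot_poly k t = (\<Sum>m\<in>T. \<Sum>w\<in>{w \<in> ballots {1..k}. length w = m}. t ^ length w)"
    unfolding ballot_poly_def using assms by (intro sum.group[symmetric] finite_ballots) auto
  also have "\<dots> = (\<Sum>m\<in>T. of_nat (ballot_count k m) * t ^ m)"
    by (intro sum.cong) (auto simp: ballot_count_def)
  finally show ?thesis .
qed

lemma two_sided_caylerian_eq_sum_burge_count:
  assumes "finite T" "dim_row ` burge_matrices n \<subseteq> T" "dim_col ` burge_matrices n \<subseteq> T"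
  shows "two_sided_caylerian n s t = (\<Sum>i\<in>T. \<Sum>j\<in>T. of_nat (burge_count n i j) * (s ^ i * t ^ j))"
proof -
  have "two_sided_caylerian n s t = (\<Sum>P\<in>T \<times> T.
      \<Sum>A\<in>{A \<in> burge_matrices n. (dim_row A, dim_col A) = P}. s ^ dim_row A * t ^ dim_col A)"
    unfolding two_sided_caylerian_def using assms
    by (intro sum.group[symmetric] finite_burge_matrices) auto
  also have "\<dots> = (\<Sum>(i, j)\<in>T \<times> T. of_nat (burge_count n i j) * (s ^ i * t ^ j))"
    by (intro sum.cong) (auto simp: burge_count_def)
  finally show ?thesis by (simp add: sum.cartesian_product)
qed

text \<open>Clearing the denominator \<open>fact n\<close> makes the identity hold for
  \<open>s\<close> and \<open>t\<close> in any commutative semiring with 1, by comparing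
  coefficients of \<open>s ^ i * t ^ j\<close>.\<close>

lemma fact_times_two_sided_caylerian:
  "of_nat (fact n) * two_sided_caylerian n s t =
    (\<Sum>k\<le>n. of_nat (stirling n k) * ballot_poly k s * ballot_poly k t)"
proof -
  \<comment> \<open>One finite set containing every exponent that occurs on either side, so that the
    sums can be interchanged.\<close>
  define T where "T = dim_row ` burge_matrices n \<union> dim_col ` burge_matrices n \<union>
    (\<Union>k\<le>n. length ` ballots {1..k})"
  have fin: "finite T" by (auto simp: T_def intro: finite_burge_matrices finite_ballots)
  have "of_nat (fact n) * two_sided_caylerian n s t =
      (\<Sum>i\<in>T. \<Sum>j\<in>T. of_nat (fact n * burge_count n i j) * (s ^ i * t ^ j))"
    by (subst two_sided_caylerian_eq_sum_burge_count[OF fin])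
       (auto simp: T_def sum_distrib_left mult.assoc)
  also have "\<dots> = (\<Sum>i\<in>T. \<Sum>j\<in>T. \<Sum>k\<le>n. of_nat (stirling n k) *
      (of_nat (ballot_count k i) * s ^ i * (of_nat (ballot_count k j) * t ^ j)))"
    unfolding fact_times_burge_count by (simp add: sum_distrib_left sum_distrib_right mult_ac)
  also have "\<dots> = (\<Sum>i\<in>T. \<Sum>k\<le>n. \<Sum>j\<in>T. of_nat (stirling n k) *
      (of_nat (ballot_count k i) * s ^ i * (of_nat (ballot_count k j) * t ^ j)))"
    by (intro sum.cong refl sum.swap)
  also have "\<dots> = (\<Sum>k\<le>n. \<Sum>i\<in>T. \<Sum>j\<in>T. of_nat (stirling n k) *
      (of_nat (ballot_count k i) * s ^ i * (of_nat (ballot_count k j) * t ^ j)))"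
    by (rule sum.swap)
  also have "\<dots> = (\<Sum>k\<le>n. of_nat (stirling n k) * ballot_poly k s * ballot_poly k t)"
  proof (rule sum.cong)
    fix k assume "k \<in> {..n}"
    then have "length ` ballots {1..k} \<subseteq> T" by (auto simp: T_def)
    then have "ballot_poly k u = (\<Sum>m\<in>T. of_nat (ballot_count k m) * u ^ m)" for u :: 'a
      by (rule ballot_poly_eq_sum_ballot_count[OF fin])
    then have "ballot_poly k s * ballot_poly k t = (\<Sum>i\<in>T. \<Sum>j\<in>T.
        of_nat (ballot_count k i) * s ^ i * (of_nat (ballot_count k j) * t ^ j))"
      by (simp only: sum_product)
    then show "(\<Sum>i\<in>T. \<Sum>j\<in>T. of_nat (stirling n k) *
        (of_nat (ballot_count k i) * s ^ i * (of_nat (ballot_count k j) * t ^ j))) =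
      of_nat (stirling n k) * ballot_poly k s * ballot_poly k t"
      by (simp add: sum_distrib_left[symmetric] mult.assoc)
  qed simp
  finally show ?thesis .
qed

theorem theorem4p8:
  fixes n :: nat
  shows "(two_sided_caylerian n indet_s indet_t :: 'a::field_char_0 poly poly) =
    [:[:1 / fact n:]:] *
      (\<Sum>k = 0..n. of_nat (stirling n k) * ballot_poly k indet_s * ballot_poly k indet_t)"
proof -
  \<comment> \<open>Both factors are constant polynomials, and \<open>fact n\<close> is nonzero in
    characteristic 0.\<close>
  have "[:[:1 / fact n:]:] * of_nat (fact n) = (1 :: 'a poly poly)"
    by (simp add: of_nat_poly one_pCons del: of_nat_fact) (simp)
  then show ?thesis
    by (simp add: atLeast0AtMost fact_times_two_sided_caylerian[symmetric] mult.assoc[symmetric]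
        del: of_nat_fact mult_pCons_left)
qed

end
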